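(* For $x>0$ and $0<\sigma<1$, $$\phi\left(-\tfrac12\sigma,0;-x\right)=\frac{x}{2\sqrt{\pi}}\int_0^\infty s^{-3/2}\,e^{-x^2/(4s)}\,\phi(-\sigma,0;-s)\,ds .$$
   Context: For real $\rho\in(-1,0)\cup(0,\infty)$ and real $z$, the reduced Wright function is $\phi(\rho,0;z)=\sum_{n=1}^\infty \frac{z^n}{n!\,\Gamma(\rho n)}$, where $1/\Gamma$ is the entire reciprocal gamma function (equal to $0$ at $0,-1,-2,\ldots$). *)

theory Defs
  imports "HOL-Analysis.Analysis"
begin

text \<open>
  The reduced Wright function $\phi(\rho, 0; z)$, meant for
  $\rho \in (-1,0) \cup (0,\infty)$, where the series converges absolutely for every $z$.
  The index is shifted: the summand for \<open>n\<close> is the term of index \<open>n + 1\<close> of the series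
  $\sum_{n \ge 1} z^n / (n!\, \Gamma(\rho n))$. The entire function \<^const>\<open>rGamma\<close> is used
  because $\rho n$ can be a pole of $\Gamma$.
\<close>

definition reduced_wright :: "real \<Rightarrow> real \<Rightarrow> real" where
  "reduced_wright \<rho> z =
     (\<Sum>n. z ^ Suc n / fact (Suc n) * rGamma (\<rho> * real (Suc n)))"

end

theory Submission
  imports Defs "HOL-Complex_Analysis.Conformal_Mappings" "HOL-Probability.Distributions"
    "HOL-Real_Asymp.Real_Asymp"
begin

text \<open>
  Reflection turns the coefficients \<open>1 / \<Gamma>(-\<sigma>n)\<close> into \<open>\<Gamma>(1 + \<sigma>n) sin (\<pi>(1 + \<sigma>n)) / \<pi>\<close>; inserting
  Euler's integral, rotated to a ray of direction \<open>\<theta> \<in> (\<pi>/2, \<pi>)\<close>, and summing the series gives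
  the Hankel-type formula
  \<open>\<phi>(-\<sigma>, 0; z) = Im (\<integral>r>0. e\<^sup>i\<^sup>\<theta> exp (r e\<^sup>i\<^sup>\<theta> + z r\<^sup>\<sigma> e\<^sup>i\<^sup>\<theta>\<^sup>\<sigma>)) / \<pi>\<close>.
  If moreover \<open>\<theta>\<sigma> < \<pi>/2\<close>, then for \<open>z = -s \<le> 0\<close> the integrand is dominated by \<open>exp (r cos \<theta>)\<close>, so
  Fubini applies, and the integral over \<open>s\<close> is the Laplace transform of the one-sided stable law of
  index \<open>1/2\<close> at \<open>p = r\<^sup>\<sigma> e\<^sup>i\<^sup>\<theta>\<^sup>\<sigma>\<close>. It equals \<open>exp (-x \<surd>p)\<close> up to the constant \<open>2 \<surd>\<pi> / x\<close>, which is
  the same formula with \<open>\<sigma>/2\<close> for \<open>\<sigma>\<close> and the same ray.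
\<close>

section \<open>Termwise integration of the exponential series and continuation of Laplace
  identities\<close>

text \<open>Dominated convergence: every partial sum of the series is bounded by the majorant in
  \<open>dom\<close>. It serves both to expand a Laplace transform in a power series and to sum the
  Wright series under the integral.\<close>

lemma integral_mult_exp_sums:
  fixes f g :: "'a \<Rightarrow> complex"
  assumes [measurable]: "f \<in> borel_measurable M" "g \<in> borel_measurable M"
    and dom: "integrable M (\<lambda>x. norm (f x) * exp (norm (g x)))"
  shows "integrable M (\<lambda>x. f x * exp (g x))"
    and "integrable M (\<lambda>x. f x * (g x ^ n / fact n))"
    and "(\<lambda>n. \<integral>x. f x * (g x ^ n / fact n) \<partial>M) sums (\<integral>x. f x * exp (g x) \<partial>M)"
proof -
  \<comment> \<open>A general finite \<open>A\<close> covers both uses: a singleton for a single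
    term, an initial segment for a partial sum.\<close>
  have le: "(\<Sum>i\<in>A. norm (g x) ^ i / fact i) \<le> exp (norm (g x))" if "finite A" for x A
    using sum_le_suminf[OF summable_exp_generic[of "norm (g x)"], of A] that
    by (simp add: exp_def scaleR_conv_of_real divide_inverse mult.commute)
  have int: "integrable M (\<lambda>x. f x * (g x ^ n / fact n))" for n
  proof (rule Bochner_Integration.integrable_bound[OF dom])
    show "AE x in M. norm (f x * (g x ^ n / fact n)) \<le> norm (norm (f x) * exp (norm (g x)))"
    proof (rule AE_I2)
      fix x show "norm (f x * (g x ^ n / fact n)) \<le> norm (norm (f x) * exp (norm (g x)))"
        using mult_left_mono[OF le[of "{n}" x], of "norm (f x)"]
        by (simp add: norm_mult norm_divide norm_power)
    qed
  qed measurable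
  then show "integrable M (\<lambda>x. f x * (g x ^ n / fact n))" .
  have partial: "norm (\<Sum>i<N. f x * (g x ^ i / fact i)) \<le> norm (f x) * exp (norm (g x))" for x N
  proof -
    have "norm (\<Sum>i<N. f x * (g x ^ i / fact i)) \<le> norm (f x) * (\<Sum>i<N. norm (g x) ^ i / fact i)"
      unfolding sum_distrib_left
      by (rule sum_norm_le) (simp add: norm_mult norm_divide norm_power)
    also have "\<dots> \<le> norm (f x) * exp (norm (g x))"
      by (intro mult_left_mono le) auto
    finally show ?thesis .
  qed
  have lim: "(\<lambda>N. \<Sum>i<N. f x * (g x ^ i / fact i)) \<longlonglongrightarrow> f x * exp (g x)" for x
    using exp_converges[of "g x"] unfolding sums_def sum_distrib_left[symmetric]
    by (intro tendsto_intros) (simp add: scaleR_conv_of_real divide_inverse mult.commute)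
  have bnd: "AE x in M. norm (\<Sum>i<N. f x * (g x ^ i / fact i)) \<le> norm (f x) * exp (norm (g x))" for N
    using partial by simp
  have lim': "AE x in M. (\<lambda>N. \<Sum>i<N. f x * (g x ^ i / fact i)) \<longlonglongrightarrow> f x * exp (g x)"
    using lim by simp
  have meas: "(\<lambda>x. f x * exp (g x)) \<in> borel_measurable M"
       "\<And>N. (\<lambda>x. \<Sum>i<N. f x * (g x ^ i / fact i)) \<in> borel_measurable M"
    by measurable
  show "integrable M (\<lambda>x. f x * exp (g x))"
    by (rule integrable_dominated_convergence[OF meas dom lim' bnd])
  have "(\<lambda>N. \<integral>x. (\<Sum>i<N. f x * (g x ^ i / fact i)) \<partial>M) \<longlonglongrightarrow> (\<integral>x. f x * exp (g x) \<partial>M)"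
    by (rule integral_dominated_convergence[OF meas dom lim' bnd])
  then show "(\<lambda>n. \<integral>x. f x * (g x ^ n / fact n) \<partial>M) sums (\<integral>x. f x * exp (g x) \<partial>M)"
    unfolding sums_def by (subst (asm) Bochner_Integration.integral_sum) (use int in auto)
qed

text \<open>The identity theorem replaces a contour deformation: the transform is a power series on
  a disc centred at a positive real number, and it agrees with \<open>G\<close> on the real diameter
  of that disc.\<close>

lemma laplace_identity_extend:
  fixes K :: "real \<Rightarrow> real" and G :: "complex \<Rightarrow> complex"
  assumes [measurable]: "K \<in> borel_measurable lborel"
    and supp: "\<And>s. s < 0 \<Longrightarrow> K s = 0"
    and lap: "\<And>q. q > 0 \<Longrightarrow> has_bochner_integral lborel (\<lambda>s. K s * exp (- (q * s))) (g q)"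
    and G: "\<And>q. q > 0 \<Longrightarrow> G (of_real q) = of_real (g q)"
    and hol: "G holomorphic_on {z. 0 < Re z}"
    and p: "0 < Re p"
  shows "has_bochner_integral lborel (\<lambda>s. of_real (K s) * exp (- (p * of_real s))) (G p)"
proof -
  define L where "L z = (\<integral>s. complex_of_real (K s) * exp (- (z * of_real s)) \<partial>lborel)" for z
  have int: "integrable lborel (\<lambda>s. complex_of_real (K s) * exp (- (p * of_real s)))"
  proof (rule Bochner_Integration.integrable_bound)
    show "integrable lborel (\<lambda>s. K s * exp (- (Re p * s)))"
      using lap[OF p] by (simp add: has_bochner_integral_iff)
  qed (auto simp: norm_mult)
  \<comment> \<open>Chosen so that the ball around \<open>q\<close> that touches the imaginary axis at \<open>0\<close> contains \<open>p\<close>.\<close>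
  define q where "q = (norm p)\<^sup>2 / Re p"
  have "p \<noteq> 0" using p by auto
  then have q: "q > 0" using p by (simp add: q_def)
  have "(norm (of_real q - p))\<^sup>2 = (norm p)\<^sup>2 + q\<^sup>2 - 2 * (q * Re p)"
    unfolding cmod_power2 by (simp add: power2_eq_square algebra_simps)
  also have "q * Re p = (norm p)\<^sup>2" using p by (simp add: q_def)
  also have "(norm p)\<^sup>2 + q\<^sup>2 - 2 * (norm p)\<^sup>2 < q\<^sup>2" using \<open>p \<noteq> 0\<close> by simp
  finally have "norm (of_real q - p) < q" using q by (simp add: power2_less_imp_less)
  then have pball: "p \<in> ball (of_real q) q" by (simp add: dist_norm)
  have ballpos: "0 < Re w" if "w \<in> ball (of_real q) q" for w
  proof -
    have "\<bar>Re (of_real q - w)\<bar> < q" using that abs_Re_le_cmod[of "of_real q - w"]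
      by (simp only: mem_ball dist_norm)
    then show ?thesis by simp
  qed
  have "L holomorphic_on ball (of_real q) q"
  proof (rule power_series_holomorphic)
    fix w assume w: "w \<in> ball (complex_of_real q) q"
    let ?f = "\<lambda>s. complex_of_real (K s) * exp (- (of_real q * of_real s))"
    let ?g = "\<lambda>s. - ((w - of_real q) * complex_of_real s)"
    define d where "d = norm (w - of_real q)"
    have d: "d < q" using w by (simp add: d_def dist_norm norm_minus_commute)
    \<comment> \<open>On the support \<open>\<bar>s\<bar> = s\<close>, so the growth
      \<open>exp (d * s)\<close> only lowers the rate from \<open>q\<close> to \<open>q - d\<close>,
      which is still positive; \<open>lap\<close> applies there.\<close>
    have "integrable lborel (\<lambda>s. norm (?f s) * exp (norm (?g s)))"
    proof (rule Bochner_Integration.integrable_bound)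
      show "integrable lborel (\<lambda>s. K s * exp (- ((q - d) * s)))"
        using lap[of "q-d"] d by (auto simp: has_bochner_integral_iff)
      show "AE s in lborel. norm (norm (?f s) * exp (norm (?g s))) \<le> norm (K s * exp (- ((q - d) * s)))"
      proof (rule AE_I2)
        fix s
        have "norm (?g s) = d * \<bar>s\<bar>"
          by (simp only: norm_minus_cancel norm_mult norm_of_real d_def)
        moreover have "norm (?f s) = \<bar>K s\<bar> * exp (- (q * s))"
          by (simp add: norm_mult)
        moreover have "exp (- (q * s)) * exp (d * s) = exp (- ((q - d) * s))"
          by (simp add: exp_add[symmetric] algebra_simps)
        ultimately show "norm (norm (?f s) * exp (norm (?g s))) \<le> norm (K s * exp (- ((q - d) * s)))"
          by (cases "s < 0") (simp_all add: supp abs_mult mult.assoc)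
      qed
    qed measurable
    from integral_mult_exp_sums(3)[OF _ _ this]
    have "(\<lambda>n. \<integral>s. ?f s * (?g s ^ n / fact n) \<partial>lborel) sums (\<integral>s. ?f s * exp (?g s) \<partial>lborel)" by simp
    also have "(\<lambda>s. ?f s * exp (?g s)) = (\<lambda>s. of_real (K s) * exp (- (w * of_real s)))"
      by (simp add: exp_add[symmetric] mult.assoc algebra_simps)
    also have "(\<lambda>n. \<integral>s. ?f s * (?g s ^ n / fact n) \<partial>lborel) =
        (\<lambda>n. (\<integral>s. ?f s * ((- of_real s) ^ n / fact n) \<partial>lborel) * (w - of_real q) ^ n)"
    proof (rule ext)
      fix n
      have "?g s ^ n = (- of_real s) ^ n * (w - of_real q) ^ n" for s
        by (simp add: power_mult_distrib[symmetric] algebra_simps)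
      then show "(\<integral>s. ?f s * (?g s ^ n / fact n) \<partial>lborel) =
        (\<integral>s. ?f s * ((- of_real s) ^ n / fact n) \<partial>lborel) * (w - of_real q) ^ n"
        by (subst integral_mult_left_zero[symmetric]) (simp add: mult_ac)
    qed
    finally show "(\<lambda>n. (\<integral>s. ?f s * ((- of_real s) ^ n / fact n) \<partial>lborel) * (w - of_real q) ^ n) sums L w"
      unfolding L_def .
  qed
  moreover have "G holomorphic_on ball (of_real q) q"
    by (rule holomorphic_on_subset[OF hol]) (use ballpos in auto)
  ultimately have hol': "(\<lambda>z. L z - G z) holomorphic_on ball (of_real q) q"
    by (rule holomorphic_on_diff)
  have "L p - G p = 0"
  proof (rule analytic_continuation[OF hol' open_ball connected_ball])
    let ?U = "complex_of_real ` {0<..<2*q}"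
    show "?U \<subseteq> ball (of_real q) q"
      by (auto simp: dist_of_real dist_real_def)
    show "of_real q \<in> ball (complex_of_real q) q" using q by simp
    have "q islimpt {0<..<2*q}" using q
      by (simp add: islimpt_greaterThanLessThan1 open_imp_islimpt interior_limit_point)
    then show "complex_of_real q islimpt ?U"
      by (rule islimpt_isCont_image) (auto simp: eventually_at intro!: exI[of _ 1])
    show "L z - G z = 0" if z: "z \<in> ?U" for z
    proof -
      obtain t where t: "z = of_real t" "t > 0" using z by auto
      have "L z = (\<integral>s. complex_of_real (K s * exp (- (t * s))) \<partial>lborel)"
        unfolding L_def t by (simp add: exp_of_real[symmetric])
      also have "\<dots> = of_real (g t)"
        using has_bochner_integral_integral_eq[OF lap[OF t(2)]] by (simp only: integral_complex_of_real)
      finally show ?thesis using t G by simp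
    qed
    show "p \<in> ball (complex_of_real q) q" by (fact pball)
  qed
  then show ?thesis using int by (simp add: has_bochner_integral_iff L_def)
qed


section \<open>Euler's integral with real and complex rates\<close>

lemma Gamma_laplace_real:
  fixes a q :: real
  assumes a: "a > 0" and q: "q > 0"
  shows "has_bochner_integral lborel
    (\<lambda>s. indicator {0<..} s * s powr (a - 1) * exp (- (q * s))) (Gamma a * q powr (- a))"
proof -
  define f where "f s = indicator {0<..} s * s powr (a - 1) * exp (- s)" for s :: real
  have "has_bochner_integral lborel f (Gamma a)"
  proof (rule has_bochner_integral_nn_integral)
    show "f \<in> borel_measurable lborel" unfolding f_def by measurable
    show "AE s in lborel. 0 \<le> f s" by (simp add: f_def)
    show "0 \<le> Gamma a" using Gamma_real_pos[OF a] by simp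
    show "(\<integral>\<^sup>+ s. ennreal (f s) \<partial>lborel) = ennreal (Gamma a)"
      unfolding Gamma_conv_nn_integral_real[OF a]
      by (intro nn_integral_cong) (auto simp: f_def indicator_def exp_minus divide_inverse)
  qed
  then have "has_bochner_integral lborel (\<lambda>s. f (0 + q * s)) (Gamma a /\<^sub>R \<bar>q\<bar>)"
    using q by (subst lborel_has_bochner_integral_real_affine_iff[symmetric]) auto
  \<comment> \<open>The factor \<open>q powr (1 - a)\<close> cancels the power of \<open>q\<close>
    that the substitution \<open>q * s\<close> produces.\<close>
  then have "has_bochner_integral lborel (\<lambda>s. q powr (1 - a) * f (0 + q * s)) (q powr (1 - a) * (Gamma a /\<^sub>R \<bar>q\<bar>))"
    by (rule has_bochner_integral_mult_right)
  also have "(\<lambda>s. q powr (1 - a) * f (0 + q * s)) = (\<lambda>s. indicator {0<..} s * s powr (a - 1) * exp (- (q * s)))"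
  proof
    fix s
    have "q powr (1 - a) * q powr (a - 1) = 1" using q by (simp add: powr_add[symmetric])
    then show "q powr (1 - a) * f (0 + q * s) = indicator {0<..} s * s powr (a - 1) * exp (- (q * s))"
      using q by (auto simp: f_def indicator_def powr_mult zero_less_mult_iff)
  qed
  also have "q powr (1 - a) * (Gamma a /\<^sub>R \<bar>q\<bar>) = Gamma a * q powr (- a)"
    using q by (simp add: powr_diff powr_minus divide_inverse)
  finally show ?thesis .
qed

text \<open>This is Euler's integral along a rotated ray: a complex rate \<open>p\<close> takes the
  place of the rotation.\<close>

lemma Gamma_laplace_complex:
  fixes a :: real and p :: complex
  assumes a: "a > 0" and p: "Re p > 0"
  shows "has_bochner_integral lborel
    (\<lambda>s. of_real (indicator {0<..} s * s powr (a - 1)) * exp (- (p * of_real s)))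
    (of_real (Gamma a) * p powr (- of_real a))"
proof (rule laplace_identity_extend[where g = "\<lambda>q. Gamma a * q powr (- a)"])
  show "(\<lambda>s. indicator {0<..} s * s powr (a - 1)) \<in> borel_measurable lborel" by measurable
  show "(\<lambda>p. of_real (Gamma a) * p powr (- of_real a)) holomorphic_on {z. 0 < Re z}"
    by (intro holomorphic_intros) (auto simp: complex_nonpos_Reals_iff)
  show "of_real (Gamma a) * (of_real q :: complex) powr (- of_real a) = of_real (Gamma a * q powr (- a))" if "q > 0" for q
    using that powr_of_real[of q "-a"] by simp
qed (use Gamma_laplace_real[OF a] p in \<open>auto simp: mult.assoc\<close>)

section \<open>Laplace transform of the one-sided stable density of index 1/2\<close>

text \<open>An unnormalised error function. Its limits at both ends feed the boundary terms of an
  explicit antiderivative; the one at \<open>at_bot\<close> follows from oddness.\<close>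

lemma gaussian_antiderivative:
  obtains E :: "real \<Rightarrow> real" where
    "\<And>y. (E has_real_derivative exp (- y\<^sup>2)) (at y)" "E 0 = 0"
    "(E \<longlongrightarrow> sqrt pi / 2) at_top" "(E \<longlongrightarrow> - (sqrt pi / 2)) at_bot"
proof -
  define E where "E y = (LBINT t=0..ereal y. exp (- t\<^sup>2))" for y :: real
  have D: "(E has_real_derivative exp (- y\<^sup>2)) (at y)" for y
  proof -
    \<comment> \<open>The fundamental theorem is stated on a closed interval; this \<open>m\<close>
      puts both \<open>0\<close> and \<open>y\<close> in its interior.\<close>
    define m where "m = \<bar>y\<bar> + 1"
    have "((\<lambda>u. LBINT t=0..ereal u. exp (- t\<^sup>2)) has_vector_derivative exp (- y\<^sup>2)) (at y within {-m..m})"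
      by (rule interval_integral_FTC2[of "-m" 0 m, simplified zero_ereal_def[symmetric]])
         (auto simp: m_def intro!: continuous_intros)
    moreover have "at y within {-m..m} = at y"
      by (rule at_within_interior) (auto simp: m_def)
    ultimately show ?thesis
      by (simp add: E_def[abs_def] has_real_derivative_iff_has_vector_derivative)
  qed
  have E0: "E 0 = 0" by (simp add: E_def zero_ereal_def[symmetric])
  have "((\<lambda>y. \<integral>x. indicator {..y} x *\<^sub>R (indicator {0..} x *\<^sub>R exp (- x\<^sup>2)) \<partial>lborel) \<longlongrightarrow>
      (\<integral>x. indicator {0..} x *\<^sub>R exp (- (x::real)\<^sup>2) \<partial>lborel)) at_top"
    using gaussian_moment_0 by (intro tendsto_integral_at_top) (auto simp: has_bochner_integral_iff)
  also have "(\<integral>x. indicator {0..} x *\<^sub>R exp (- (x::real)\<^sup>2) \<partial>lborel) = sqrt pi / 2"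
    using gaussian_moment_0 by (simp add: has_bochner_integral_iff)
  finally have lim: "(E \<longlongrightarrow> sqrt pi / 2) at_top"
  proof (rule Lim_transform_eventually)
    show "\<forall>\<^sub>F y in at_top. (\<integral>x. indicator {..y} x *\<^sub>R (indicator {0..} x *\<^sub>R exp (- x\<^sup>2)) \<partial>lborel) = E y"
      using eventually_ge_at_top[of 0]
    proof eventually_elim
      case (elim y)
      then show ?case
        unfolding E_def zero_ereal_def interval_integral_Icc[OF elim] set_lebesgue_integral_def
        by (intro Bochner_Integration.integral_cong) (auto simp: indicator_def)
    qed
  qed
  have odd: "E (- y) = - E y" for y
  proof -
    have "((\<lambda>y. E (- y) + E y) has_real_derivative 0) (at y)" for y
      by (auto intro!: derivative_eq_intros DERIV_chain2[OF D] D)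
    then have "E (- y) + E y = E (- 0) + E 0"
      using DERIV_isconst_all[of "\<lambda>y. E (- y) + E y" y 0] by auto
    then show ?thesis using E0 by simp
  qed
  have "((\<lambda>y. - E (- y)) \<longlongrightarrow> - (sqrt pi / 2)) at_bot"
    by (intro tendsto_minus filterlim_compose[OF lim] filterlim_uminus_at_top_at_bot)
  then have "(E \<longlongrightarrow> - (sqrt pi / 2)) at_bot" by (simp add: odd)
  with D E0 lim show ?thesis by (rule that)
qed

text \<open>The integrand has an elementary antiderivative in terms of the error function. The case
  \<open>q = 0\<close> is included because it gives the integrability of the density itself.\<close>

lemma levy_laplace_real:
  fixes x q :: real
  assumes x: "x > 0" and q: "q \<ge> 0"
  shows "has_bochner_integral lborel
    (\<lambda>s. indicator {0<..} s * (s powr (-3/2) * exp (- x\<^sup>2 / (4 * s))) * exp (- (q * s)))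
    (2 * sqrt pi / x * exp (- (x * sqrt q)))"
proof -
  obtain E where E: "\<And>y. (E has_real_derivative exp (- y\<^sup>2)) (at y)" "E 0 = 0"
    "(E \<longlongrightarrow> sqrt pi / 2) at_top" "(E \<longlongrightarrow> - (sqrt pi / 2)) at_bot"
    using gaussian_antiderivative by blast
  define b where "b = sqrt q"
  have b: "b \<ge> 0" "q = b\<^sup>2" using q by (auto simp: b_def)
  \<comment> \<open>Completing the square: \<open>u\<^sup>2 + x b = v\<^sup>2 - x b = q s + x\<^sup>2 / (4 s)\<close>.\<close>
  define u where "u s = b * sqrt s - x / (2 * sqrt s)" for s
  define v where "v s = b * sqrt s + x / (2 * sqrt s)" for s
  \<comment> \<open>After the chain rule both terms carry the same exponential, and
    \<open>u' - v' = x / (2 * s * sqrt s)\<close>; the factor \<open>2 / x\<close> normalises this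
    to \<open>s powr (-3/2)\<close>.\<close>
  define F where "F s = 2 / x * (exp (- (x * b)) * E (u s) - exp (x * b) * E (v s))" for s
  define f where "f s = s powr (-3/2) * exp (- x\<^sup>2 / (4 * s)) * exp (- (q * s))" for s
  have D: "(F has_real_derivative f s) (at s)" if s: "s > 0" for s
  proof -
    have powr: "s powr (-3/2) = inverse (s * sqrt s)"
      using s powr_add[of s 1 "1/2"] by (simp add: powr_minus powr_half_sqrt)
    have ss: "sqrt s * sqrt s = s" "sqrt s > 0" using s by auto
    have u': "(u has_real_derivative (b / (2 * sqrt s) + x / (4 * (s * sqrt s)))) (at s)"
      unfolding u_def using s ss
      by (auto intro!: derivative_eq_intros simp: field_simps power2_eq_square)
    have v': "(v has_real_derivative (b / (2 * sqrt s) - x / (4 * (s * sqrt s)))) (at s)"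
      unfolding v_def using s ss
      by (auto intro!: derivative_eq_intros simp: field_simps power2_eq_square)
    have uu: "- (u s)\<^sup>2 = x * b - q * s - x\<^sup>2 / (4 * s)"
      unfolding u_def b(2) power2_diff using s by (simp add: power_mult_distrib power_divide)
    have vv: "- (v s)\<^sup>2 = - (x * b) - q * s - x\<^sup>2 / (4 * s)"
      unfolding v_def b(2) power2_sum using s by (simp add: power_mult_distrib power_divide)
    define e where "e = exp (- x\<^sup>2 / (4 * s)) * exp (- (q * s))"
    have "exp (- (x * b)) * exp (- (u s)\<^sup>2) = e" "exp (x * b) * exp (- (v s)\<^sup>2) = e"
      unfolding uu vv e_def by (simp_all add: exp_add[symmetric])
    moreover have "(F has_real_derivative 2 / x *
        (exp (- (x * b)) * (exp (- (u s)\<^sup>2) * (b / (2 * sqrt s) + x / (4 * (s * sqrt s)))) -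
         exp (x * b) * (exp (- (v s)\<^sup>2) * (b / (2 * sqrt s) - x / (4 * (s * sqrt s)))))) (at s)"
      unfolding F_def
      by (intro DERIV_cmult DERIV_diff DERIV_chain2[OF E(1)] u' v')
    ultimately have "(F has_real_derivative 2 / x *
        (e * (b / (2 * sqrt s) + x / (4 * (s * sqrt s))) - e * (b / (2 * sqrt s) - x / (4 * (s * sqrt s))))) (at s)"
      by (simp only: mult.assoc[symmetric])
    also have "2 / x *
        (e * (b / (2 * sqrt s) + x / (4 * (s * sqrt s))) - e * (b / (2 * sqrt s) - x / (4 * (s * sqrt s)))) = f s"
      unfolding f_def powr mult.assoc e_def[symmetric] using x s by (simp add: field_simps)
    finally show ?thesis .
  qed
  have L0: "((F \<circ> real_of_ereal) \<longlongrightarrow> 2 / x * (exp (- (x * b)) * (- (sqrt pi / 2)) - exp (x * b) * (sqrt pi / 2))) (at_right 0)"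
  proof -
    have "filterlim u at_bot (at_right 0)" "filterlim v at_top (at_right 0)"
      unfolding u_def v_def using x b by real_asymp+
    then have "(F \<longlongrightarrow> 2 / x * (exp (- (x * b)) * (- (sqrt pi / 2)) - exp (x * b) * (sqrt pi / 2))) (at_right 0)"
      unfolding F_def by (intro tendsto_intros filterlim_compose[OF E(3)] filterlim_compose[OF E(4)])
    then show ?thesis by (simp add: zero_ereal_def ereal_tendsto_simps)
  qed
  have Linf: "((F \<circ> real_of_ereal) \<longlongrightarrow> 2 / x * (exp (- (x * b)) * (sqrt pi / 2) - exp (x * b) * (sqrt pi / 2))) (at_left \<infinity>)"
  \<comment> \<open>For \<open>b = 0\<close> both arguments tend to \<open>0\<close> instead of
    infinity, but the two terms cancel in either case, so the limit has the same form.\<close>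
  proof (cases "b = 0")
    case True
    have "isCont E 0" using E(1) DERIV_isCont by blast
    moreover have "(u \<longlongrightarrow> 0) at_top" "(v \<longlongrightarrow> 0) at_top"
      unfolding u_def v_def True by real_asymp+
    ultimately have "(F \<longlongrightarrow> 2 / x * (exp (- (x * b)) * E 0 - exp (x * b) * E 0)) at_top"
      unfolding F_def by (intro tendsto_intros isCont_tendsto_compose[of 0 E])
    then show ?thesis using True by (simp add: ereal_tendsto_simps)
  next
    case False
    with b have "b > 0" by simp
    then have "filterlim u at_top at_top" "filterlim v at_top at_top"
      unfolding u_def v_def by real_asymp+
    then have "(F \<longlongrightarrow> 2 / x * (exp (- (x * b)) * (sqrt pi / 2) - exp (x * b) * (sqrt pi / 2))) at_top"
      unfolding F_def by (intro tendsto_intros filterlim_compose[OF E(3)])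
    then show ?thesis by (simp add: ereal_tendsto_simps)
  qed
  have cont: "isCont f s" if "s > 0" for s
    unfolding f_def using that by (intro continuous_intros) auto
  have f_nonneg: "0 \<le> f s" for s by (simp add: f_def)
  \<comment> \<open>As \<open>f\<close> is nonnegative, the finite boundary limits of
    \<open>F\<close> yield integrability along with the value.\<close>
  have 1: "set_integrable lborel (einterval 0 \<infinity>) f"
    "(LBINT s=0..\<infinity>. f s) = 2 / x * (exp (- (x * b)) * (sqrt pi / 2) - exp (x * b) * (sqrt pi / 2))
      - 2 / x * (exp (- (x * b)) * (- (sqrt pi / 2)) - exp (x * b) * (sqrt pi / 2))"
    by (rule interval_integral_FTC_nonneg[OF _ _ _ _ L0 Linf]; use D cont f_nonneg in simp)+
  have ei: "einterval 0 \<infinity> = {0<..}" by (auto simp: einterval_def)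
  have eq: "(\<lambda>s. indicator {0<..} s * (s powr (-3/2) * exp (- x\<^sup>2 / (4 * s))) * exp (- (q * s))) =
    (\<lambda>s. indicator {0<..} s *\<^sub>R f s)" by (simp add: f_def mult.assoc)
  \<comment> \<open>The \<open>exp (x * b)\<close> terms agree at both ends and cancel; only the
    jump \<open>sqrt pi\<close> of \<open>E\<close> along \<open>u\<close> remains.\<close>
  have "2 / x * (exp (- (x * b)) * (sqrt pi / 2) - exp (x * b) * (sqrt pi / 2))
      - 2 / x * (exp (- (x * b)) * (- (sqrt pi / 2)) - exp (x * b) * (sqrt pi / 2)) = 
     2 * sqrt pi / x * exp (- (x * sqrt q))"
    using x unfolding b_def by (simp add: field_simps)
  with 1 show ?thesis
    unfolding eq has_bochner_integral_iff set_integrable_def ei interval_lebesgue_integral_0_infty set_lebesgue_integral_def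
    by simp
qed

text \<open>The principal root is holomorphic on the right half-plane and extends the real one, so
  the real formula continues.\<close>

lemma levy_laplace_complex:
  fixes x :: real and p :: complex
  assumes x: "x > 0" and p: "Re p > 0"
  shows "has_bochner_integral lborel
    (\<lambda>s. of_real (indicator {0<..} s * (s powr (-3/2) * exp (- x\<^sup>2 / (4 * s)))) * exp (- (p * of_real s)))
    (of_real (2 * sqrt pi / x) * exp (- (of_real x * csqrt p)))"
proof (rule laplace_identity_extend[where g = "\<lambda>q. 2 * sqrt pi / x * exp (- (x * sqrt q))"])
  show "(\<lambda>p. of_real (2 * sqrt pi / x) * exp (- (of_real x * csqrt p))) holomorphic_on {z. 0 < Re z}"
    by (intro holomorphic_intros) (auto simp: complex_nonpos_Reals_iff)
  show "of_real (2 * sqrt pi / x) * exp (- (of_real x * csqrt (of_real q))) =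
      complex_of_real (2 * sqrt pi / x * exp (- (x * sqrt q)))" if "q > 0" for q
    using that by (simp add: exp_of_real[symmetric])
qed (use levy_laplace_real[OF x] p in auto)


section \<open>Hankel-type integral for the reduced Wright function\<close>

text \<open>Sublinear growth lets the exponential decay on the ray absorb the factor from the Wright
  series.\<close>

lemma powr_le_linear:
  fixes \<sigma> b c :: real
  assumes "\<sigma> < 1" "b \<ge> 0" "c > 0" "0 \<le> \<sigma>"
  obtains B where "\<And>r. r > 0 \<Longrightarrow> b * r powr \<sigma> \<le> c * r + B"
proof -
  have "((\<lambda>r. b * r powr (\<sigma> - 1)) \<longlongrightarrow> 0) at_top"
    using assms by real_asymp
  then have "eventually (\<lambda>r. b * r powr (\<sigma> - 1) < c) at_top"
    using assms by (intro order_tendstoD)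
  then obtain R where R: "\<And>r. r \<ge> R \<Longrightarrow> b * r powr (\<sigma> - 1) < c"
    by (auto simp: eventually_at_top_linorder)
  show thesis
  proof
    fix r :: real assume r: "r > 0"
    show "b * r powr \<sigma> \<le> c * r + b * max R 0 powr \<sigma>"
    proof (cases "r \<ge> R")
      case True
      have "b * r powr \<sigma> = b * r powr (\<sigma> - 1) * r"
        using r powr_add[of r "\<sigma> - 1" 1] by simp
      also have "\<dots> \<le> c * r" using R[OF True] r by (intro mult_right_mono) auto
      finally show ?thesis using assms by (simp add: add_increasing2)
    next
      case False
      then have "r powr \<sigma> \<le> max R 0 powr \<sigma>" using r assms by (intro powr_mono2) auto
      then have "b * r powr \<sigma> \<le> b * max R 0 powr \<sigma>" using assms by (intro mult_left_mono) auto
      then show ?thesis using r assms by (simp add: add_increasing)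
    qed
  qed
qed

lemma integrable_exp_neg:
  fixes q :: real
  assumes "q > 0"
  shows "integrable lborel (\<lambda>s. indicator {0<..} s * exp (- (q * s)))"
proof -
  have "(\<lambda>s. indicator {0<..} s * s powr (1 - 1) * exp (- (q * s))) = (\<lambda>s. indicator {0<..} s * exp (- (q * s)))"
    by (auto simp: indicator_def)
  then show ?thesis using Gamma_laplace_real[of 1 q] assms by (simp add: has_bochner_integral_iff)
qed

text \<open>The reflection formula, kept in terms of \<open>rGamma\<close> so that it remains valid
  when \<open>1 - a\<close> is a pole of \<open>Gamma\<close>.\<close>

lemma rGamma_one_minus_real:
  fixes a :: real
  assumes "a > 0"
  shows "rGamma (1 - a) = Gamma a * sin (pi * a) / pi"
proof -
  have "complex_of_real (rGamma a * rGamma (1 - a)) = of_real (sin (pi * a) / pi)"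
    using rGamma_reflection_complex[of "of_real a"]
    by (simp add: rGamma_complex_of_real[symmetric] sin_of_real[symmetric])
  then have "rGamma a * rGamma (1 - a) = sin (pi * a) / pi"
    by (simp only: of_real_eq_iff)
  moreover have "Gamma a * rGamma a = 1"
    using Gamma_real_pos[OF assms] by (simp add: rGamma_inverse_Gamma)
  ultimately show ?thesis
    by (metis (no_types, lifting) mult.assoc mult_1 times_divide_eq_right)
qed

text \<open>The integrand \<open>e\<^sup>z dz/dr\<close> on the upper ray \<open>z = r e\<^sup>i\<^sup>\<theta>\<close> of a Hankel contour.\<close>

definition hankel_ray :: "real \<Rightarrow> real \<Rightarrow> complex" where
  "hankel_ray \<theta> r = of_real (indicator {0<..} r) * (cis \<theta> * exp (of_real r * cis \<theta>))"

lemma borel_measurable_hankel_ray [measurable]: "hankel_ray \<theta> \<in> borel_measurable borel"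
  unfolding hankel_ray_def[abs_def] by measurable

lemma norm_hankel_ray: "norm (hankel_ray \<theta> r) = indicator {0<..} r * exp (- (- cos \<theta> * r))"
  by (simp add: hankel_ray_def norm_mult mult.commute)

lemma integrable_hankel_ray:
  assumes "cos \<theta> < 0"
  shows "integrable lborel (\<lambda>r. norm (hankel_ray \<theta> r))"
  unfolding norm_hankel_ray by (rule integrable_exp_neg) (use assms in simp)

lemma cis_minus_pi: "cis (\<theta> - pi) = - cis \<theta>"
  by (simp add: complex_eq_iff)

lemma cis_powr_of_real:
  assumes "- pi < t" "t \<le> pi"
  shows "cis t powr (of_real a) = cis (t * a)"
  using assms by (simp add: powr_def cis_conv_exp mult_ac)

text \<open>Up to \<open>z ^ n / fact n\<close>, this integrates
  \<open>w powr (a - 1) * exp w\<close> along the ray \<open>w = r * cis \<theta>\<close>. The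
  phases \<open>\<theta> * a\<close> and \<open>- (\<theta> - pi) * a\<close> combine to
  \<open>pi * a\<close>, so the value does not depend on the ray.\<close>

lemma hankel_ray_moment:
  fixes \<sigma> \<theta> z :: real and n :: nat
  assumes \<sigma>: "0 < \<sigma>" and \<theta>: "pi / 2 < \<theta>" "\<theta> < pi" and c: "cos \<theta> < 0"
  defines "a \<equiv> 1 + \<sigma> * real n"
  shows "(\<integral>r. hankel_ray \<theta> r * ((of_real (z * r powr \<sigma>) * cis (\<theta> * \<sigma>)) ^ n / fact n) \<partial>lborel)
    = of_real (z ^ n / fact n * Gamma a) * cis (pi * a)"
proof -
  have a: "a > 0" using \<sigma> by (simp add: a_def add_pos_nonneg)
  let ?k = "of_real (z ^ n / fact n) * cis (\<theta> * a)"
  have "hankel_ray \<theta> r * ((of_real (z * r powr \<sigma>) * cis (\<theta> * \<sigma>)) ^ n / fact n) =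
      ?k * (of_real (indicator {0<..} r * r powr (a - 1)) * exp (- (cis (\<theta> - pi) * of_real r)))" for r
  proof (cases "r > 0")
    case True
    have "(r powr \<sigma>) ^ n = r powr (a - 1)"
      using True by (simp add: powr_power a_def mult.commute)
    moreover have "cis \<theta> * cis (\<theta> * \<sigma>) ^ n = cis (\<theta> * a)"
      by (simp add: Complex.DeMoivre cis_mult a_def algebra_simps)
    ultimately show ?thesis
      using True by (simp add: hankel_ray_def cis_minus_pi power_mult_distrib of_real_power[symmetric]
          mult_ac del: of_real_power)
  qed (simp add: hankel_ray_def)
  then have "(\<integral>r. hankel_ray \<theta> r * ((of_real (z * r powr \<sigma>) * cis (\<theta> * \<sigma>)) ^ n / fact n) \<partial>lborel)
     = ?k * (\<integral>r. of_real (indicator {0<..} r * r powr (a - 1)) * exp (- (cis (\<theta> - pi) * of_real r)) \<partial>lborel)"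
    by simp
  also have "\<dots> = ?k * (of_real (Gamma a) * cis (\<theta> - pi) powr (- of_real a))"
    by (subst has_bochner_integral_integral_eq[OF Gamma_laplace_complex[OF a]]) (use c in \<open>simp_all add: cis_minus_pi\<close>)
  \<comment> \<open>The rate \<open>- cis \<theta>\<close> is written as
    \<open>cis (\<theta> - pi)\<close> because \<open>\<theta> - pi\<close> is its principal
    argument.\<close>
  also have "cis (\<theta> - pi) powr (- of_real a) = cis (- (\<theta> - pi) * a)"
    using cis_powr_of_real[of "\<theta> - pi" "-a"] \<theta> by (simp add: algebra_simps)
  also have "?k * (of_real (Gamma a) * cis (- (\<theta> - pi) * a)) =
      of_real (z ^ n / fact n * Gamma a) * (cis (\<theta> * a) * cis (- (\<theta> - pi) * a))"
    by (simp add: mult_ac)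
  also have "cis (\<theta> * a) * cis (- (\<theta> - pi) * a) = cis (pi * a)"
    by (simp add: cis_mult algebra_simps)
  finally show ?thesis .
qed

text \<open>The imaginary part turns \<open>cis (pi * a)\<close> into the sine of the reflection
  formula. Any ray in the open second quadrant is allowed, so one \<open>\<theta>\<close> can serve
  two values of \<open>\<sigma>\<close>.\<close>

lemma reduced_wright_hankel:
  fixes \<sigma> \<theta> z :: real
  assumes \<sigma>: "0 < \<sigma>" "\<sigma> < 1" and \<theta>: "pi / 2 < \<theta>" "\<theta> < pi"
  shows "reduced_wright (- \<sigma>) z =
     Im (\<integral>r. hankel_ray \<theta> r * exp (of_real (z * r powr \<sigma>) * cis (\<theta> * \<sigma>)) \<partial>lborel) / pi"
    (is "_ = Im ?I / pi")
proof -
  have c: "cos \<theta> < 0"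
    using cos_monotone_0_pi[of "pi/2" \<theta>] \<theta> by simp
  \<comment> \<open>Half of the decay rate \<open>- cos \<theta>\<close> is spent on the series; the
    other half keeps the majorant integrable.\<close>
  obtain B where B: "\<And>r. r > 0 \<Longrightarrow> \<bar>z\<bar> * r powr \<sigma> \<le> (- cos \<theta> / 2) * r + B"
    using powr_le_linear[of \<sigma> "\<bar>z\<bar>" "- cos \<theta> / 2"] \<sigma> c by auto
  let ?g = "\<lambda>r. of_real (z * r powr \<sigma>) * cis (\<theta> * \<sigma>)"
  have "integrable lborel (\<lambda>r. norm (hankel_ray \<theta> r) * exp (norm (?g r)))"
  proof (rule Bochner_Integration.integrable_bound)
    show "integrable lborel (\<lambda>r. exp B * (indicator {0<..} r * exp (- ((- cos \<theta> / 2) * r))))"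
      using c by (intro integrable_mult_right integrable_exp_neg) auto
    show "AE r in lborel. norm (norm (hankel_ray \<theta> r) * exp (norm (?g r)))
        \<le> norm (exp B * (indicator {0<..} r * exp (- ((- cos \<theta> / 2) * r))))"
    proof (rule AE_I2)
      fix r
      show "norm (norm (hankel_ray \<theta> r) * exp (norm (?g r)))
        \<le> norm (exp B * (indicator {0<..} r * exp (- ((- cos \<theta> / 2) * r))))"
      proof (cases "r > 0")
        case True
        then show ?thesis using B[OF True]
          by (simp add: norm_hankel_ray norm_mult abs_mult exp_add[symmetric])
      qed (simp add: norm_hankel_ray)
    qed
  qed measurable
  from integral_mult_exp_sums(3)[OF _ _ this]
  have "(\<lambda>n. of_real (z ^ n / fact n * Gamma (1 + \<sigma> * real n)) * cis (pi * (1 + \<sigma> * real n))) sums ?I"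
    unfolding hankel_ray_moment[OF \<sigma>(1) \<theta> c] by simp
  then have "(\<lambda>n. Im (of_real (z ^ n / fact n * Gamma (1 + \<sigma> * real n)) * cis (pi * (1 + \<sigma> * real n))) / pi) sums (Im ?I / pi)"
    by (intro sums_divide sums_Im)
  moreover have "Im (of_real (z ^ n / fact n * Gamma (1 + \<sigma> * real n)) * cis (pi * (1 + \<sigma> * real n))) / pi
      = z ^ n / fact n * rGamma (- \<sigma> * real n)" for n
    unfolding times_complex.sel Re_complex_of_real Im_complex_of_real cis.sel
    using rGamma_one_minus_real[of "1 + \<sigma> * real n"] \<sigma> by (simp add: add_pos_nonneg)
  ultimately have "(\<lambda>n. z ^ n / fact n * rGamma (- \<sigma> * real n)) sums (Im ?I / pi)"
    by simp
  \<comment> \<open>Dropping index \<open>0\<close> leaves the sum unchanged, since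
    \<open>rGamma 0 = 0\<close>.\<close>
  then have "(\<lambda>n. z ^ Suc n / fact (Suc n) * rGamma (- \<sigma> * real (Suc n))) sums (Im ?I / pi)"
    by (subst sums_Suc_iff) simp
  then show ?thesis unfolding reduced_wright_def by (rule sums_unique[symmetric])
qed

section \<open>The integral identity by Fubini's theorem\<close>

lemma csqrt_polar:
  assumes "r > 0" "- pi < t" "t < pi"
  shows "csqrt (of_real (r powr b) * cis t) = of_real (r powr (b / 2)) * cis (t / 2)"
proof (rule csqrt_unique)
  have "(r powr (b / 2))\<^sup>2 = r powr b"
    using assms by (simp add: power2_eq_square powr_add[symmetric])
  then show "(of_real (r powr (b / 2)) * cis (t / 2))\<^sup>2 = of_real (r powr b) * cis t"
    by (simp add: power_mult_distrib Complex.DeMoivre of_real_power[symmetric] del: of_real_power)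
  have "0 < cos (t / 2)" using assms by (intro cos_gt_zero_pi) auto
  then show "0 < Re (of_real (r powr (b / 2)) * cis (t / 2)) \<or>
     Re (of_real (r powr (b / 2)) * cis (t / 2)) = 0 \<and> 0 \<le> Im (of_real (r powr (b / 2)) * cis (t / 2))"
    using assms by simp
qed

theorem theorem2:
  fixes x \<sigma> :: real
  assumes "x > 0" and "0 < \<sigma>" and "\<sigma> < 1"
  shows "set_integrable lborel {0<..}
           (\<lambda>s. s powr (-3/2) * exp (- x\<^sup>2 / (4 * s)) * reduced_wright (-\<sigma>) (-s)) \<and>
         reduced_wright (- (1/2) * \<sigma>) (-x) =
           x / (2 * sqrt pi) *
           (LBINT s:{0<..}. s powr (-3/2) * exp (- x\<^sup>2 / (4 * s)) * reduced_wright (-\<sigma>) (-s))"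
proof -
  \<comment> \<open>Since \<open>\<sigma> < 1\<close>, some angle beyond \<open>pi / 2\<close> still
    keeps \<open>\<theta> * \<sigma>\<close> below \<open>pi / 2\<close>: the ray decays while
    \<open>r powr \<sigma> * cis (\<theta> * \<sigma>)\<close> has positive real part.\<close>
  have "pi / 2 < min pi (pi / (2 * \<sigma>))" using assms by (simp add: field_simps)
  then obtain \<theta> where \<theta>: "pi / 2 < \<theta>" "\<theta> < pi" and "\<theta> < pi / (2 * \<sigma>)"
    using dense by (metis min_less_iff_conj)
  then have \<theta>\<sigma>: "\<theta> * \<sigma> < pi / 2" using assms by (simp add: field_simps)
  have \<theta>\<sigma>0: "0 < \<theta> * \<sigma>" using assms \<theta> pi_gt_zero by (intro mult_pos_pos) linarith+
  have c: "cos \<theta> < 0" using cos_monotone_0_pi[of "pi/2" \<theta>] \<theta> by simp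
  have c\<sigma>: "cos (\<theta> * \<sigma>) > 0" using \<theta>\<sigma> \<theta>\<sigma>0 by (intro cos_gt_zero) auto
  define k :: "real \<Rightarrow> real" where "k s = indicator {0<..} s * (s powr (-3/2) * exp (- x\<^sup>2 / (4 * s)))" for s
  have k [measurable]: "k \<in> borel_measurable borel" unfolding k_def[abs_def] by measurable
  have k_int: "integrable lborel k"
    using levy_laplace_real[OF assms(1), of 0] by (simp add: has_bochner_integral_iff k_def[abs_def])
  have k_nonneg: "k s \<ge> 0" for s by (simp add: k_def)
  define f where "f s r = of_real (k s) * (hankel_ray \<theta> r * exp (of_real (- s * r powr \<sigma>) * cis (\<theta> * \<sigma>)))" for s r
  have f_int: "integrable (lborel \<Otimes>\<^sub>M lborel) (case_prod f)"
  proof (rule Bochner_Integration.integrable_bound)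
    show "integrable (lborel \<Otimes>\<^sub>M lborel) (\<lambda>(s, r). k s * norm (hankel_ray \<theta> r))"
      by (rule lborel_pair.Fubini_integrable)
         (auto simp: abs_mult intro!: integrable_mult_right integrable_mult_left integrable_abs k_int integrable_hankel_ray c)
    show "case_prod f \<in> borel_measurable (lborel \<Otimes>\<^sub>M lborel)"
      unfolding f_def[abs_def] by measurable
    \<comment> \<open>For \<open>s > 0\<close> the remaining exponential has modulus at most 1
      because \<open>cos (\<theta> * \<sigma>) > 0\<close>; for other \<open>s\<close> the factor
      \<open>k s\<close> vanishes.\<close>
    have "norm (f s r) \<le> k s * norm (hankel_ray \<theta> r)" for s r
    proof (cases "s > 0")
      case True
      have "norm (exp (of_real (- s * r powr \<sigma>) * cis (\<theta> * \<sigma>))) \<le> 1"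
        using True c\<sigma> by simp
      then show ?thesis
        unfolding f_def norm_mult using k_nonneg
        by (intro mult_mono mult_left_le) (auto simp: k_nonneg)
    qed (simp add: f_def k_def)
    then show "AE p in lborel \<Otimes>\<^sub>M lborel. norm (case_prod f p) \<le> norm (case p of (s, r) \<Rightarrow> k s * norm (hankel_ray \<theta> r))"
      using k_nonneg by (auto simp: abs_mult)
  qed
  have inner_r: "indicator {0<..} s *\<^sub>R (s powr (-3/2) * exp (- x\<^sup>2 / (4 * s)) * reduced_wright (-\<sigma>) (-s)) =
      Im (\<integral>r. f s r \<partial>lborel) / pi" for s
    unfolding reduced_wright_hankel[OF assms(2,3) \<theta>] f_def integral_mult_right_zero
    by (simp add: k_def)
  have inner_s: "(\<integral>s. f s r \<partial>lborel) =
      of_real (2 * sqrt pi / x) * (hankel_ray \<theta> r * exp (of_real (- x * r powr (\<sigma> / 2)) * cis (\<theta> * (\<sigma> / 2))))" for r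
  proof (cases "r > 0")
    case True
    let ?p = "of_real (r powr \<sigma>) * cis (\<theta> * \<sigma>)"
    have "f s r = hankel_ray \<theta> r * (of_real (k s) * exp (- (?p * of_real s)))" for s
      by (simp add: f_def mult_ac)
    then have "(\<integral>s. f s r \<partial>lborel) = hankel_ray \<theta> r * (\<integral>s. of_real (k s) * exp (- (?p * of_real s)) \<partial>lborel)"
      by simp
    also have "(\<integral>s. of_real (k s) * exp (- (?p * of_real s)) \<partial>lborel) =
        of_real (2 * sqrt pi / x) * exp (- (of_real x * csqrt ?p))"
      unfolding k_def
      by (rule has_bochner_integral_integral_eq[OF levy_laplace_complex]) (use True assms c\<sigma> in auto)
    \<comment> \<open>The root halves both exponent and angle, which is exactly the passage from
      \<open>\<sigma>\<close> to \<open>\<sigma> / 2\<close> on the same ray.\<close>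
    also have "csqrt ?p = of_real (r powr (\<sigma> / 2)) * cis (\<theta> * \<sigma> / 2)"
      using True \<theta>\<sigma> \<theta>\<sigma>0 pi_gt_zero by (intro csqrt_polar) linarith+
    finally show ?thesis by (simp add: mult_ac)
  qed (simp add: f_def hankel_ray_def)
  have fst_int: "integrable lborel (\<lambda>s. \<integral>r. f s r \<partial>lborel)"
    using lborel_pair.integrable_fst[OF f_int] .
  have "set_integrable lborel {0<..}
           (\<lambda>s. s powr (-3/2) * exp (- x\<^sup>2 / (4 * s)) * reduced_wright (-\<sigma>) (-s))"
    unfolding set_integrable_def inner_r using fst_int by simp
  moreover have "(LBINT s:{0<..}. s powr (-3/2) * exp (- x\<^sup>2 / (4 * s)) * reduced_wright (-\<sigma>) (-s)) =
      2 * sqrt pi / x * reduced_wright (- (\<sigma> / 2)) (- x)"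
  proof -
    have "(LBINT s:{0<..}. s powr (-3/2) * exp (- x\<^sup>2 / (4 * s)) * reduced_wright (-\<sigma>) (-s)) =
        (\<integral>s. Im (\<integral>r. f s r \<partial>lborel) \<partial>lborel) / pi"
      unfolding set_lebesgue_integral_def inner_r by simp
    also have "(\<integral>s. Im (\<integral>r. f s r \<partial>lborel) \<partial>lborel) = Im (\<integral>s. (\<integral>r. f s r \<partial>lborel) \<partial>lborel)"
      by (rule integral_Im[OF fst_int])
    also have "(\<integral>s. (\<integral>r. f s r \<partial>lborel) \<partial>lborel) = (\<integral>r. (\<integral>s. f s r \<partial>lborel) \<partial>lborel)"
      by (rule lborel_pair.Fubini_integral[OF f_int, symmetric])
    also have "Im \<dots> / pi = 2 * sqrt pi / x * reduced_wright (- (\<sigma> / 2)) (- x)"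
      using reduced_wright_hankel[of "\<sigma> / 2" \<theta> "- x"] assms \<theta>
      unfolding inner_s integral_mult_right_zero by simp
    finally show ?thesis .
  qed
  ultimately show ?thesis using assms by simp
qed


end
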